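(* Let $\mathfrak{A}$ be a residuated lattice. The following assertions are equivalent: (1) any $\alpha$-filter of $\mathfrak{A}$ is principal; (2) any $\omega$-filter of $\mathfrak{A}$ is principal; (3) any coannulet of $\mathfrak{A}$ is principal and any minimal prime filter of $\mathfrak{A}$ is non-dense; (4) any prime $\alpha$-filter of $\mathfrak{A}$ is principal. Further, any one of the assertions (1), (2), (3), (4) implies that $\mathfrak{A}$ is quasicomplemented.
   Context: A residuated lattice $\mathfrak{A}=(A;\vee,\wedge,\odot,\rightarrow,0,1)$ is an algebra such that $\ell(\mathfrak{A}):=(A;\vee,\wedge,0,1)$ is a bounded lattice, $(A;\odot,1)$ is a commutative monoid, and $x\odot y\leq z$ iff $x\leq y\rightarrow z$. A filter is a non-empty $F\subseteq A$ closed under $\odot$ and such that $x\in F$, $y\in A$ imply $x\vee y\in F$; it is proper if $F\neq A$. A filter is principal if it equals $\mathscr{F}(x)$, the filter generated by $x$, for some $x\in A$. A prime filter is a proper filter $P$ such that $x\vee y\in P$ implies $x\in P$ or $y\in P$; a minimal prime filter is a prime filter minimal under inclusion among all prime filters. For $X\subseteq A$, $X^{\perp}=\{a\in A\mid a\vee x=1\ \forall x\in X\}$; $x^{\perp}:=\{x\}^{\perp}$ and $x^{\perp\perp}:=(x^{\perp})^{\perp}$. A subset $X$ of $A$ is dense if $X^{\perp}=\{1\}$, and non-dense otherwise. Coannulets are the filters of the form $x^{\perp}$, $x\in A$. For a (non-empty, possibly improper) ideal $I$ of the lattice $\ell(\mathfrak{A})$, $\omega(I)=\{a\in A\mid a\vee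 x=1\text{ for some }x\in I\}$; this is a filter, and the filters of this form are called $\omega$-filters. A filter $F$ is an $\alpha$-filter if $x^{\perp\perp}\subseteq F$ for every $x\in F$; a prime $\alpha$-filter is a prime filter that is an $\alpha$-filter. $\mathfrak{A}$ is quasicomplemented if for every $x\in A$ there is $y\in A$ with $x^{\perp\perp}=y^{\perp}$. *)

theory Defs
  imports Main
begin

unbundle lattice_syntax

(* The bounded lattice comes from bounded_lattice, with least element bot as the constant 0;
   the monoid operation is written times.  The unit 1 of the monoid is the greatest element. *)
class residuated_lattice = bounded_lattice + comm_monoid_mult +
  fixes residuum :: "'a \<Rightarrow> 'a \<Rightarrow> 'a"
  assumes top_eq_one: "\<top> = 1"
    and residuation: "x * y \<le> z \<longleftrightarrow> x \<le> residuum y z"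

definition rl_filter :: "'a::residuated_lattice set \<Rightarrow> bool" where
  "rl_filter F \<longleftrightarrow>
     F \<noteq> {} \<and> (\<forall>x\<in>F. \<forall>y\<in>F. x * y \<in> F) \<and> (\<forall>x\<in>F. \<forall>y. x \<squnion> y \<in> F)"

definition generated_filter :: "'a::residuated_lattice set \<Rightarrow> 'a set" where
  "generated_filter X = \<Inter>{F. rl_filter F \<and> X \<subseteq> F}"

definition principal_filter :: "'a::residuated_lattice set \<Rightarrow> bool" where
  "principal_filter F \<longleftrightarrow> (\<exists>x. F = generated_filter {x})"

definition prime_filter :: "'a::residuated_lattice set \<Rightarrow> bool" where
  "prime_filter P \<longleftrightarrow>
     rl_filter P \<and> P \<noteq> UNIV \<and> (\<forall>x y. x \<squnion> y \<in> P \<longrightarrow> x \<in> P \<or> y \<in> P)"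

definition minimal_prime_filter :: "'a::residuated_lattice set \<Rightarrow> bool" where
  "minimal_prime_filter P \<longleftrightarrow>
     prime_filter P \<and> (\<forall>Q. prime_filter Q \<and> Q \<subseteq> P \<longrightarrow> Q = P)"

definition coannihilator :: "'a::residuated_lattice set \<Rightarrow> 'a set" where
  "coannihilator X = {a. \<forall>x\<in>X. a \<squnion> x = 1}"

definition dense_set :: "'a::residuated_lattice set \<Rightarrow> bool" where
  "dense_set X \<longleftrightarrow> coannihilator X = {1}"

definition coannulet :: "'a::residuated_lattice set \<Rightarrow> bool" where
  "coannulet F \<longleftrightarrow> (\<exists>x. F = coannihilator {x})"

definition lattice_ideal :: "'a::residuated_lattice set \<Rightarrow> bool" where
  "lattice_ideal I \<longleftrightarrow>
     I \<noteq> {} \<and> (\<forall>x\<in>I. \<forall>y\<in>I. x \<squnion> y \<in> I) \<and> (\<forall>x\<in>I. \<forall>y. y \<le> x \<longrightarrow> y \<in> I)"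

definition omega :: "'a::residuated_lattice set \<Rightarrow> 'a set" where
  "omega I = {a. \<exists>x\<in>I. a \<squnion> x = 1}"

definition omega_filter :: "'a::residuated_lattice set \<Rightarrow> bool" where
  "omega_filter F \<longleftrightarrow> (\<exists>I. lattice_ideal I \<and> F = omega I)"

definition alpha_filter :: "'a::residuated_lattice set \<Rightarrow> bool" where
  "alpha_filter F \<longleftrightarrow> rl_filter F \<and> (\<forall>x\<in>F. coannihilator (coannihilator {x}) \<subseteq> F)"

(* A property of the whole algebra, hence of its type. *)
definition quasicomplemented :: "'a::residuated_lattice itself \<Rightarrow> bool" where
  "quasicomplemented _ \<longleftrightarrow>
     (\<forall>x::'a. \<exists>y. coannihilator (coannihilator {x}) = coannihilator {y})"

end

(* With S / y := {z. z \<squnion> y \<in> S}, residuals of filters (of alpha-filters) by elements are again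
   filters (alpha-filters); this replaces explicit descriptions of generated filters throughout.

   (1) implies (2) because omega-filters are alpha-filters, and (2) implies (3) because a minimal
   prime P equals omega (- P): if P is generated by p, then some x outside P satisfies
   p \<squnion> x = 1, and x annihilates P.  For (3) implies (4): principal coannulets make the algebra
   quasicomplemented, hence every prime alpha-filter P is minimal, and an element c \<noteq> 1 annihilating
   P gives P = coannihilator {c}.  (4) implies (1) is a Cohen-type argument: an alpha-filter maximal
   among the non-principal ones is prime. *)
theory Submission
  imports Defs
begin

unbundle lattice_syntax

section \<open>Filters of a residuated lattice\<close>

lemma rl_le_one: "(x::'a::residuated_lattice) \<le> 1"
  using top_greatest[of x] by (simp add: top_eq_one)

lemma rl_sup_one [simp]:
  "(x::'a::residuated_lattice) \<squnion> 1 = 1" "1 \<squnion> (x::'a::residuated_lattice) = 1"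
  by (simp_all add: rl_le_one sup_absorb1 sup_absorb2)

lemma rl_mult_mono:
  fixes a b c :: "'a::residuated_lattice"
  assumes "a \<le> b"
  shows "a * c \<le> b * c"
proof -
  have "b \<le> residuum c (b * c)" using residuation by blast
  with assms have "a \<le> residuum c (b * c)" by (rule order_trans)
  then show ?thesis using residuation by blast
qed

lemma rl_mult_le:
  fixes x y :: "'a::residuated_lattice"
  shows "x * y \<le> x" "x * y \<le> y"
proof -
  show *: "x * y \<le> y" for x y :: 'a using rl_mult_mono[OF rl_le_one, of x y] by simp
  show "x * y \<le> x" using *[of y x] by (simp add: mult.commute)
qed

text \<open>Residuation makes multiplication distribute over joins. Expanding the product on the
  left, every term except \<open>x * y\<close> has \<open>z\<close> as a factor and so lies below
  \<open>z\<close>.\<close>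

lemma rl_sup_mult_le:
  fixes x y z :: "'a::residuated_lattice"
  shows "(x \<squnion> z) * (y \<squnion> z) \<le> x * y \<squnion> z"
proof -
  have "y * x \<le> x * y \<squnion> z" "z * x \<le> x * y \<squnion> z"
    by (simp add: mult.commute) (rule le_supI2[OF rl_mult_le(1)])
  then have "y \<squnion> z \<le> residuum x (x * y \<squnion> z)" by (simp add: residuation)
  then have "x * (y \<squnion> z) \<le> x * y \<squnion> z" by (metis residuation mult.commute)
  moreover have "z * (y \<squnion> z) \<le> x * y \<squnion> z" by (rule le_supI2[OF rl_mult_le(1)])
  ultimately have "x \<squnion> z \<le> residuum (y \<squnion> z) (x * y \<squnion> z)" by (simp add: residuation)
  then show ?thesis by (simp add: residuation)
qed

section \<open>Filters and their residuals by elements\<close>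

lemma rl_filter_mult: "rl_filter F \<Longrightarrow> x \<in> F \<Longrightarrow> y \<in> F \<Longrightarrow> x * y \<in> F"
  by (simp add: rl_filter_def)

lemma rl_filter_supI1: "rl_filter F \<Longrightarrow> x \<in> F \<Longrightarrow> x \<squnion> y \<in> F"
  by (simp add: rl_filter_def)

lemma rl_filter_up: "rl_filter F \<Longrightarrow> x \<in> F \<Longrightarrow> x \<le> y \<Longrightarrow> y \<in> F"
  by (metis rl_filter_supI1 sup_absorb2)

lemma rl_filter_one: "rl_filter F \<Longrightarrow> 1 \<in> F"
  unfolding rl_filter_def using rl_sup_one(1) by (metis ex_in_conv)

lemma rl_filter_bot: "rl_filter F \<Longrightarrow> \<bottom> \<in> F \<longleftrightarrow> F = UNIV"
  using rl_filter_up[of F \<bottom>] by auto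

text \<open>This has two uses: to show that a generated filter lies in a residual it suffices to
  test the generators, and in the maximality arguments the residual serves as the larger
  filter.\<close>

lemma rl_filter_residual:
  assumes "rl_filter F"
  shows "rl_filter {z. z \<squnion> y \<in> F}"
  unfolding rl_filter_def
proof (intro conjI ballI allI)
  show "{z. z \<squnion> y \<in> F} \<noteq> {}" using rl_filter_one[OF assms] by (auto intro!: exI[of _ 1])
next
  fix a b assume "a \<in> {z. z \<squnion> y \<in> F}" "b \<in> {z. z \<squnion> y \<in> F}"
  then have "(a \<squnion> y) * (b \<squnion> y) \<in> F" by (simp add: rl_filter_mult[OF assms])
  then show "a * b \<in> {z. z \<squnion> y \<in> F}" using rl_filter_up[OF assms _ rl_sup_mult_le] by simp
next
  fix a b assume "a \<in> {z. z \<squnion> y \<in> F}"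
  then show "a \<squnion> b \<in> {z. z \<squnion> y \<in> F}"
    using rl_filter_supI1[OF assms, of "a \<squnion> y" b] by (simp add: ac_simps)
qed

lemma rl_filter_subset_residual: "rl_filter F \<Longrightarrow> F \<subseteq> {z. z \<squnion> y \<in> F}"
  by (auto intro: rl_filter_supI1)

lemma rl_filter_singleton_one: "rl_filter {1 :: 'a::residuated_lattice}"
  by (simp add: rl_filter_def)

lemma rl_filter_Inter:
  assumes "\<And>F. F \<in> C \<Longrightarrow> rl_filter F"
  shows "rl_filter (\<Inter>C)"
  unfolding rl_filter_def using assms rl_filter_one rl_filter_mult rl_filter_supI1 by blast

lemma rl_filter_Union_chain:
  assumes "subset.chain A C" "C \<noteq> {}" "\<And>F. F \<in> C \<Longrightarrow> rl_filter F"
  shows "rl_filter (\<Union>C)"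
  unfolding rl_filter_def
proof (intro conjI ballI allI)
  show "\<Union>C \<noteq> {}" using assms(2,3) rl_filter_one by blast
next
  fix x y assume "x \<in> \<Union>C" "y \<in> \<Union>C"
  then obtain F G where "F \<in> C" "x \<in> F" "G \<in> C" "y \<in> G" by blast
  moreover from this assms(1) have "F \<subseteq> G \<or> G \<subseteq> F" by (auto simp: subset.chain_def)
  ultimately show "x * y \<in> \<Union>C" using assms(3) rl_filter_mult by blast
next
  fix x y assume "x \<in> \<Union>C"
  then show "x \<squnion> y \<in> \<Union>C" using assms(3) rl_filter_supI1 by blast
qed

section \<open>Generated and principal filters\<close>

lemma rl_filter_generated: "rl_filter (generated_filter X)"
  unfolding generated_filter_def by (rule rl_filter_Inter) simp

lemma generated_filter_superset: "X \<subseteq> generated_filter X"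
  by (auto simp: generated_filter_def)

lemma generated_filter_least: "rl_filter F \<Longrightarrow> X \<subseteq> F \<Longrightarrow> generated_filter X \<subseteq> F"
  by (auto simp: generated_filter_def)

lemma generated_filter_Int:
  "generated_filter {u} \<inter> generated_filter {v} \<subseteq> generated_filter {u \<squnion> v}"
proof
  fix a assume a: "a \<in> generated_filter {u} \<inter> generated_filter {v}"
  let ?G = "generated_filter {u \<squnion> v}"
  have res: "rl_filter {z. z \<squnion> y \<in> ?G}" for y
    by (rule rl_filter_residual[OF rl_filter_generated])
  have "u \<squnion> v \<in> ?G" using generated_filter_superset by blast
  \<comment> \<open>The residual of \<open>?G\<close> by \<open>v\<close> contains \<open>u\<close>,
    hence \<open>a\<close>. Then the residual by \<open>a\<close> contains \<open>v\<close>, hence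
    again \<open>a\<close>, and idempotence of the join finishes.\<close>
  with a have "a \<squnion> v \<in> ?G" using generated_filter_least[OF res, of "{u}" v] by auto
  with a have "a \<squnion> a \<in> ?G"
    using generated_filter_least[OF res, of "{v}" a] by (auto simp: sup.commute)
  then show "a \<in> ?G" by simp
qed

lemma principal_UNIV: "principal_filter (UNIV :: 'a::residuated_lattice set)"
  unfolding principal_filter_def
  using rl_filter_bot[OF rl_filter_generated[of "{\<bottom>::'a}"]] generated_filter_superset[of "{\<bottom>::'a}"]
  by auto

text \<open>The assumptions force \<open>P = F \<inter> G\<close>, since
  \<open>w = w \<squnion> w\<close> for a common element \<open>w\<close>; the join of the two
  generators then generates \<open>P\<close>.\<close>

lemma principal_filter_Int:
  assumes "principal_filter F" "principal_filter G"
    and "rl_filter P" "P \<subseteq> F" "P \<subseteq> G"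
    and "\<And>u v. u \<in> F \<Longrightarrow> v \<in> G \<Longrightarrow> u \<squnion> v \<in> P"
  shows "principal_filter P"
proof -
  obtain u v where uv: "F = generated_filter {u}" "G = generated_filter {v}"
    using assms(1,2) by (auto simp: principal_filter_def)
  then have "u \<squnion> v \<in> P" using assms(6) generated_filter_superset by blast
  then have "generated_filter {u \<squnion> v} \<subseteq> P" by (simp add: generated_filter_least assms(3))
  with generated_filter_Int[of u v] assms(4,5) uv have "P = generated_filter {u \<squnion> v}" by blast
  then show ?thesis by (auto simp: principal_filter_def)
qed

section \<open>Prime filters and their separation from ideals\<close>

lemma prime_filter_filter: "prime_filter P \<Longrightarrow> rl_filter P"
  by (simp add: prime_filter_def)

lemma prime_filter_ideal_Compl:
  assumes "prime_filter P"
  shows "lattice_ideal (- P)"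
  unfolding lattice_ideal_def
  using assms rl_filter_up[OF prime_filter_filter[OF assms]] by (auto simp: prime_filter_def)

text \<open>A filter \<open>M\<close> maximal among those disjoint from \<open>J\<close> is prime;
  \<open>{1}\<close> starts the Zorn argument.\<close>

lemma prime_filter_separation:
  assumes "lattice_ideal J" "(1 :: 'a::residuated_lattice) \<notin> J"
  obtains Q where "prime_filter Q" "Q \<inter> J = {}"
proof -
  define A where "A = {F :: 'a set. rl_filter F \<and> F \<inter> J = {}}"
  have "{1} \<in> A" using assms(2) by (simp add: A_def rl_filter_singleton_one)
  moreover have "\<Union>C \<in> A" if "C \<noteq> {}" "subset.chain A C" for C
    using rl_filter_Union_chain[OF that(2,1)] that(2) by (auto simp: A_def subset.chain_def)
  ultimately obtain M where M: "M \<in> A" "\<And>X. X \<in> A \<Longrightarrow> M \<subseteq> X \<Longrightarrow> X = M"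
    using subset_Zorn_nonempty[of A] by blast
  have fM: "rl_filter M" and disj: "M \<inter> J = {}" using M(1) by (auto simp: A_def)
  \<comment> \<open>The residual of \<open>M\<close> by \<open>y\<close> contains \<open>x\<close>,
    so it properly extends \<open>M\<close> and must meet \<open>J\<close>.\<close>
  have enlarge: "\<exists>j\<in>J. j \<squnion> y \<in> M" if "x \<squnion> y \<in> M" "x \<notin> M" for x y
    using M(2)[OF _ rl_filter_subset_residual[OF fM]] rl_filter_residual[OF fM, of y] that
    unfolding A_def by blast
  have "x \<in> M \<or> y \<in> M" if xy: "x \<squnion> y \<in> M" for x y
  proof (rule ccontr)
    assume "\<not> (x \<in> M \<or> y \<in> M)"
    with xy obtain j where "j \<in> J" "y \<squnion> j \<in> M" "y \<notin> M"
      using enlarge by (metis sup.commute)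
    \<comment> \<open>The second enlargement replaces \<open>y\<close> by a member of
      \<open>J\<close> as well, so that a join of two members of \<open>J\<close> lands in
      \<open>M\<close>.\<close>
    then obtain k where "k \<in> J" "k \<squnion> j \<in> M" using enlarge by blast
    with \<open>j \<in> J\<close> show False using disj assms(1) by (auto simp: lattice_ideal_def)
  qed
  moreover have "M \<noteq> UNIV" using disj assms(1) by (auto simp: lattice_ideal_def)
  ultimately have "prime_filter M" using fM by (auto simp: prime_filter_def)
  with disj show ?thesis using that by blast
qed

section \<open>Coannihilators, omega-filters and alpha-filters\<close>

lemma coannihilator_singleton [simp]: "a \<in> coannihilator {x} \<longleftrightarrow> a \<squnion> x = 1"
  by (simp add: coannihilator_def)

lemma rl_filter_coannihilator: "rl_filter (coannihilator X)"
proof -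
  have "rl_filter (\<Inter>x\<in>X. {a. a \<squnion> x \<in> {1}})"
    using rl_filter_residual[OF rl_filter_singleton_one] by (intro rl_filter_Inter) blast
  moreover have "coannihilator X = (\<Inter>x\<in>X. {a. a \<squnion> x \<in> {1}})" by (auto simp: coannihilator_def)
  ultimately show ?thesis by simp
qed

text \<open>Annihilation is symmetric: \<open>a\<close> annihilates \<open>X\<close> exactly when
  \<open>X\<close> lies in the filter \<open>coannihilator {a}\<close>, and such an inclusion passes
  to the generated filter.\<close>

lemma coannihilator_generated: "coannihilator (generated_filter X) = coannihilator X"
proof
  show "coannihilator (generated_filter X) \<subseteq> coannihilator X"
    using generated_filter_superset[of X] by (auto simp: coannihilator_def)
  show "coannihilator X \<subseteq> coannihilator (generated_filter X)"
  proof
    fix a assume "a \<in> coannihilator X"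
    then have "X \<subseteq> coannihilator {a}" by (auto simp: coannihilator_def sup.commute)
    then have "generated_filter X \<subseteq> coannihilator {a}"
      by (rule generated_filter_least[OF rl_filter_coannihilator])
    then show "a \<in> coannihilator (generated_filter X)"
      by (auto simp: coannihilator_def sup.commute)
  qed
qed

lemma quasicomplemented_if_coannulets_principal:
  assumes "\<forall>F::'a::residuated_lattice set. coannulet F \<longrightarrow> principal_filter F"
  shows "quasicomplemented TYPE('a)"
  unfolding quasicomplemented_def
proof
  fix x :: 'a
  obtain y where "coannihilator {x} = generated_filter {y}"
    using assms by (auto simp: coannulet_def principal_filter_def)
  then show "\<exists>y. coannihilator (coannihilator {x}) = coannihilator {y}"
    by (auto simp: coannihilator_generated)
qed

lemma mem_coannihilator2_iff:
  "b \<in> coannihilator (coannihilator {x}) \<longleftrightarrow> (\<forall>z. z \<squnion> x = 1 \<longrightarrow> z \<squnion> b = 1)"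
  by (auto simp: coannihilator_def sup.commute)

section \<open>Alpha-filters\<close>

lemma alpha_filterD:
  "alpha_filter F \<Longrightarrow> x \<in> F \<Longrightarrow> (\<And>z. z \<squnion> x = 1 \<Longrightarrow> z \<squnion> b = 1) \<Longrightarrow> b \<in> F"
  unfolding alpha_filter_def subset_iff mem_coannihilator2_iff by simp

lemma alpha_filterI:
  "rl_filter F \<Longrightarrow> (\<And>x b. x \<in> F \<Longrightarrow> (\<And>z. z \<squnion> x = 1 \<Longrightarrow> z \<squnion> b = 1) \<Longrightarrow> b \<in> F) \<Longrightarrow> alpha_filter F"
  unfolding alpha_filter_def subset_iff mem_coannihilator2_iff by simp

lemma alpha_filter_residual:
  assumes "alpha_filter F"
  shows "alpha_filter {z. z \<squnion> y \<in> F}"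
proof (rule alpha_filterI)
  show "rl_filter {z. z \<squnion> y \<in> F}"
    using assms by (simp add: alpha_filter_def rl_filter_residual)
next
  fix x b assume x: "x \<in> {z. z \<squnion> y \<in> F}" and b: "\<And>z. z \<squnion> x = 1 \<Longrightarrow> z \<squnion> b = 1"
  \<comment> \<open>The hypothesis on \<open>b\<close> is used at \<open>z \<squnion> y\<close>,
    which carries the relation between \<open>x\<close> and \<open>b\<close> over to their joins
    with \<open>y\<close>.\<close>
  have "z \<squnion> (b \<squnion> y) = 1" if "z \<squnion> (x \<squnion> y) = 1" for z
    using b[of "z \<squnion> y"] that by (simp add: ac_simps)
  then show "b \<in> {z. z \<squnion> y \<in> F}"
    using alpha_filterD[OF assms, of "x \<squnion> y" "b \<squnion> y"] x by simp
qed

lemma alpha_filter_Union_chain: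
  assumes "subset.chain A C" "C \<noteq> {}" "\<And>F. F \<in> C \<Longrightarrow> alpha_filter F"
  shows "alpha_filter (\<Union>C)"
  using rl_filter_Union_chain[OF assms(1,2)] assms(3) unfolding alpha_filter_def by blast

section \<open>Omega-filters\<close>

lemma omega_conv_UN: "omega I = (\<Union>x\<in>I. coannihilator {x})"
  by (auto simp: omega_def)

text \<open>The set is a union of coannulets, directed because \<open>I\<close> is closed under
  joins. The alpha condition holds because a witness in \<open>I\<close> for \<open>a\<close> is
  also one for \<open>b\<close>.\<close>

lemma alpha_filter_omega:
  assumes "lattice_ideal I"
  shows "alpha_filter (omega I)"
proof (rule alpha_filterI)
  show "rl_filter (omega I)"
    unfolding rl_filter_def
  proof (intro conjI ballI allI)
    obtain i where "i \<in> I" using assms by (auto simp: lattice_ideal_def)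
    then have "1 \<in> omega I" by (auto simp: omega_def)
    then show "omega I \<noteq> {}" by blast
  next
    fix a b assume "a \<in> omega I" "b \<in> omega I"
    then obtain x y where xy: "x \<in> I" "a \<squnion> x = 1" "y \<in> I" "b \<squnion> y = 1" by (auto simp: omega_def)
    have "a \<squnion> (x \<squnion> y) = (a \<squnion> x) \<squnion> y" "b \<squnion> (x \<squnion> y) = (b \<squnion> y) \<squnion> x" by (simp_all add: ac_simps)
    with xy have "a * b \<squnion> (x \<squnion> y) = 1"
      using rl_filter_mult[OF rl_filter_coannihilator, of a "{x \<squnion> y}" b] by simp
    moreover have "x \<squnion> y \<in> I" using assms xy by (simp add: lattice_ideal_def)
    ultimately show "a * b \<in> omega I" by (auto simp: omega_def)
  next
    fix a b assume "a \<in> omega I"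
    then show "a \<squnion> b \<in> omega I"
      unfolding omega_conv_UN by (auto intro: rl_filter_supI1[OF rl_filter_coannihilator]
        simp del: coannihilator_singleton)
  qed
next
  fix a b assume "a \<in> omega I" "\<And>z. z \<squnion> a = 1 \<Longrightarrow> z \<squnion> b = 1"
  then show "b \<in> omega I" by (auto simp: omega_def sup.commute)
qed

text \<open>Any witness below \<open>x\<close> can be raised to \<open>x\<close> itself. This makes
  coannulets the omega-filters of principal ideals.\<close>

lemma coannihilator_singleton_eq_omega: "coannihilator {x} = omega {..x}"
proof
  show "coannihilator {x} \<subseteq> omega {..x}" by (auto simp: omega_def)
  show "omega {..x} \<subseteq> coannihilator {x}"
  proof
    fix a assume "a \<in> omega {..x}"
    then obtain y where "y \<le> x" "a \<squnion> y = 1" by (auto simp: omega_def)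
    then have "1 \<le> a \<squnion> x" using sup_mono[OF order_refl[of a]] by metis
    then show "a \<in> coannihilator {x}" by (simp add: rl_le_one order_antisym)
  qed
qed

lemma coannulet_omega_filter: "coannulet F \<Longrightarrow> omega_filter F"
proof -
  have "lattice_ideal {..x}" for x :: 'a by (auto simp: lattice_ideal_def)
  then show "coannulet F \<Longrightarrow> omega_filter F"
    unfolding coannulet_def omega_filter_def coannihilator_singleton_eq_omega by blast
qed

section \<open>Minimal prime filters\<close>

lemma omega_Compl_subset_prime:
  assumes "prime_filter P"
  shows "omega (- P) \<subseteq> P"
  using assms rl_filter_one[OF prime_filter_filter[OF assms]]
  by (force simp: omega_def prime_filter_def)

text \<open>If some \<open>p\<close> in \<open>P\<close> were missing from
  \<open>omega (- P)\<close>, the ideal generated by \<open>p\<close> and \<open>- P\<close> would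
  omit 1. A prime filter avoiding that ideal would lie in \<open>P\<close> without containing
  \<open>p\<close>, against minimality.\<close>

lemma minimal_prime_filter_eq_omega:
  assumes "minimal_prime_filter P"
  shows "P = omega (- P)"
proof
  have prime: "prime_filter P" using assms by (simp add: minimal_prime_filter_def)
  then show "omega (- P) \<subseteq> P" by (rule omega_Compl_subset_prime)
  have ideal: "lattice_ideal (- P)" by (rule prime_filter_ideal_Compl[OF prime])
  then obtain c where c: "c \<in> - P" by (auto simp: lattice_ideal_def)
  show "P \<subseteq> omega (- P)"
  proof (rule ccontr)
    assume "\<not> P \<subseteq> omega (- P)"
    then obtain p where p: "p \<in> P" "\<And>x. x \<notin> P \<Longrightarrow> p \<squnion> x \<noteq> 1" by (auto simp: omega_def)
    \<comment> \<open>This is the ideal generated by \<open>p\<close> and \<open>- P\<close>; a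
      single \<open>x\<close> suffices because \<open>- P\<close> is closed under joins.\<close>
    define J where "J = {z. \<exists>x\<in>- P. z \<le> p \<squnion> x}"
    have "lattice_ideal J"
      unfolding lattice_ideal_def
    proof (intro conjI ballI allI impI)
      show "J \<noteq> {}" using c by (auto simp: J_def)
    next
      fix y z assume "y \<in> J" "z \<in> J"
      then obtain u v where "u \<in> - P" "v \<in> - P" "y \<le> p \<squnion> u" "z \<le> p \<squnion> v" by (auto simp: J_def)
      moreover from this have "y \<squnion> z \<le> p \<squnion> (u \<squnion> v)"
        using sup_mono[of y "p \<squnion> u" z "p \<squnion> v"] by (simp add: ac_simps)
      moreover have "u \<squnion> v \<in> - P"
        using ideal \<open>u \<in> - P\<close> \<open>v \<in> - P\<close> unfolding lattice_ideal_def by blast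
      ultimately show "y \<squnion> z \<in> J" unfolding J_def by blast
    next
      fix y z assume "y \<in> J" "z \<le> y"
      then show "z \<in> J" unfolding J_def using order_trans by blast
    qed
    moreover have "1 \<notin> J" using p(2) rl_le_one by (auto simp: J_def intro: order_antisym)
    ultimately obtain Q where Q: "prime_filter Q" "Q \<inter> J = {}"
      by (rule prime_filter_separation)
    have "p \<in> J" using c unfolding J_def by (auto intro!: bexI[of _ c])
    moreover have "- P \<subseteq> J" unfolding J_def by (auto intro!: sup_ge2)
    ultimately have "Q \<subseteq> P" "p \<notin> Q" using Q(2) by auto
    with Q(1) assms p(1) show False by (auto simp: minimal_prime_filter_def)
  qed
qed

lemma omega_filter_minimal_prime: "minimal_prime_filter P \<Longrightarrow> omega_filter P"
  unfolding omega_filter_def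
  using minimal_prime_filter_eq_omega prime_filter_ideal_Compl
  by (metis minimal_prime_filter_def)

text \<open>For a prime \<open>Q\<close> inside \<open>P\<close>, passing to complements gives
  \<open>P \<subseteq> omega (- P) \<subseteq> omega (- Q) \<subseteq> Q\<close>.\<close>

lemma minimal_prime_if_eq_omega:
  assumes "prime_filter P" "P \<subseteq> omega (- P)"
  shows "minimal_prime_filter P"
  unfolding minimal_prime_filter_def
proof (intro conjI allI impI)
  fix Q assume Q: "prime_filter Q \<and> Q \<subseteq> P"
  then have "omega (- P) \<subseteq> omega (- Q)" by (auto simp: omega_def)
  then show "Q = P" using assms(2) omega_Compl_subset_prime Q by blast
qed (fact assms(1))

lemma minimal_prime_principal_not_dense:
  assumes "minimal_prime_filter P" "principal_filter P"
  shows "\<not> dense_set P"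
proof -
  obtain p where p: "P = generated_filter {p}" using assms(2) by (auto simp: principal_filter_def)
  then have "p \<in> omega (- P)"
    using minimal_prime_filter_eq_omega[OF assms(1)] generated_filter_superset by blast
  then obtain x where x: "x \<notin> P" "p \<squnion> x = 1" by (auto simp: omega_def)
  then have "x \<in> coannihilator P" by (simp add: p coannihilator_generated sup.commute)
  moreover have "x \<noteq> 1" using x(1) rl_filter_one[OF rl_filter_generated] p by blast
  ultimately show ?thesis by (auto simp: dense_set_def)
qed

lemma prime_filter_not_dense_coannulet:
  assumes "prime_filter P" "\<not> dense_set P"
  shows "coannulet P"
proof -
  have P: "rl_filter P" using assms(1) by (rule prime_filter_filter)
  obtain c where c: "c \<in> coannihilator P" "c \<noteq> 1"
    using assms(2) rl_filter_one[OF rl_filter_coannihilator, of P] by (auto simp: dense_set_def)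
  \<comment> \<open>Otherwise \<open>c\<close> would annihilate itself, so that
    \<open>c = c \<squnion> c = 1\<close>.\<close>
  have "c \<notin> P" using c by (auto simp: coannihilator_def)
  then have "coannihilator {c} \<subseteq> P"
    using assms(1) rl_filter_one[OF P] by (force simp: prime_filter_def)
  moreover have "P \<subseteq> coannihilator {c}" using c(1) by (auto simp: coannihilator_def sup.commute)
  ultimately show ?thesis unfolding coannulet_def by blast
qed

text \<open>For \<open>x\<close> in \<open>P\<close> with quasicomplement \<open>y\<close>, the join
  of \<open>x\<close> and \<open>y\<close> is 1 while only 1 annihilates \<open>x * y\<close>. A
  proper alpha-filter therefore cannot contain both, and \<open>y\<close> witnesses
  \<open>x \<in> omega (- P)\<close>.\<close>

lemma prime_alpha_filter_minimal:
  assumes "quasicomplemented TYPE('a::residuated_lattice)"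
    and "prime_filter (P :: 'a set)" "alpha_filter P"
  shows "minimal_prime_filter P"
proof (rule minimal_prime_if_eq_omega[OF assms(2)], rule subsetI)
  fix x assume x: "x \<in> P"
  obtain y where y: "coannihilator (coannihilator {x}) = coannihilator {y}"
    using assms(1) by (auto simp: quasicomplemented_def)
  have "x \<in> coannihilator (coannihilator {x})" by (auto simp: mem_coannihilator2_iff)
  then have xy: "x \<squnion> y = 1" using y by simp
  have "y \<notin> P"
  proof
    assume "y \<in> P"
    with x have "x * y \<in> P" using assms(2) by (simp add: prime_filter_filter rl_filter_mult)
    \<comment> \<open>Such a \<open>z\<close> annihilates both \<open>x\<close> and
      \<open>y\<close>. By the choice of \<open>y\<close> it lies in the double coannihilator of
      \<open>x\<close>, so it annihilates itself and equals 1.\<close>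
    moreover have "z \<squnion> b = 1" if z: "z \<squnion> x * y = 1" for z b
    proof -
      have "z \<squnion> x = 1" "z \<squnion> y = 1"
        using sup_mono[OF order_refl[of z] rl_mult_le(1)[of x y]]
          sup_mono[OF order_refl[of z] rl_mult_le(2)[of x y]] z rl_le_one
        by (auto intro: order_antisym)
      moreover from this y have "z \<in> coannihilator (coannihilator {x})" by simp
      ultimately have "z \<squnion> z = 1" by (simp only: mem_coannihilator2_iff)
      then show ?thesis by simp
    qed
    ultimately have "b \<in> P" for b using alpha_filterD[OF assms(3)] by blast
    then show False using assms(2) by (auto simp: prime_filter_def)
  qed
  with xy show "x \<in> omega (- P)" by (auto simp: omega_def)
qed

section \<open>The Cohen-type argument\<close>

lemma alpha_filters_principal_if_primes_principal:
  assumes "\<forall>P::'a::residuated_lattice set. prime_filter P \<and> alpha_filter P \<longrightarrow> principal_filter P"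
  shows "\<forall>F::'a set. alpha_filter F \<longrightarrow> principal_filter F"
proof (rule ccontr)
  assume not: "\<not> ?thesis"
  define A where "A = {F :: 'a set. alpha_filter F \<and> \<not> principal_filter F}"
  have "A \<noteq> {}" using not by (auto simp: A_def)
  moreover have "\<Union>C \<in> A" if C: "C \<noteq> {}" "subset.chain A C" for C
  proof -
    have sub: "C \<subseteq> A" using C(2) by (auto simp: subset.chain_def)
    \<comment> \<open>A generator of the union already lies in some member of the chain, which would
      then be principal.\<close>
    have "F = generated_filter {x}" if "\<Union>C = generated_filter {x}" "F \<in> C" "x \<in> F" for x F
      using that sub generated_filter_least[of F "{x}"] by (auto simp: A_def alpha_filter_def)
    then have "\<not> principal_filter (\<Union>C)"
      using sub generated_filter_superset unfolding A_def principal_filter_def by blast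
    then show ?thesis
      using alpha_filter_Union_chain[OF C(2,1)] sub by (auto simp: A_def)
  qed
  ultimately obtain M where M: "M \<in> A" "\<And>X. X \<in> A \<Longrightarrow> M \<subseteq> X \<Longrightarrow> X = M"
    using subset_Zorn_nonempty[of A] by blast
  have alpha: "alpha_filter M" and np: "\<not> principal_filter M" using M(1) by (auto simp: A_def)
  have fM: "rl_filter M" using alpha by (simp add: alpha_filter_def)
  \<comment> \<open>The residual is an alpha-filter properly containing \<open>M\<close>, because it
    contains \<open>x\<close>; maximality makes it principal.\<close>
  have enlarge: "principal_filter {z. z \<squnion> y \<in> M}" if "x \<squnion> y \<in> M" "x \<notin> M" for x y
    using M(2)[OF _ rl_filter_subset_residual[OF fM]] alpha_filter_residual[OF alpha, of y] that
    unfolding A_def by blast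
  have "x \<in> M \<or> y \<in> M" if xy: "x \<squnion> y \<in> M" for x y
  proof (rule ccontr)
    assume contr: "\<not> (x \<in> M \<or> y \<in> M)"
    have "principal_filter {z. z \<squnion> y \<in> M}" using enlarge xy contr by blast
    then obtain u where u: "{z. z \<squnion> y \<in> M} = generated_filter {u}"
      by (auto simp: principal_filter_def)
    then have "u \<squnion> y \<in> M" using generated_filter_superset by blast
    \<comment> \<open>The element \<open>y\<close> lies in the residual by \<open>u\<close> but not
      in \<open>M\<close>, so this residual is principal too.\<close>
    then have pu: "principal_filter {z. z \<squnion> u \<in> M}"
      using enlarge[of y u] contr by (simp add: sup.commute)
    \<comment> \<open>\<open>M\<close> is the intersection of its residuals by \<open>y\<close> and
      by \<open>u\<close>: for \<open>v\<close> in the latter, the residual by \<open>v\<close>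
      contains \<open>u\<close> and hence all of \<open>generated_filter {u}\<close>.\<close>
    have "principal_filter M"
    proof (rule principal_filter_Int[of "generated_filter {u}", OF _ pu fM])
      show "principal_filter (generated_filter {u})" by (auto simp: principal_filter_def)
      show "M \<subseteq> generated_filter {u}" using rl_filter_subset_residual[OF fM] u by blast
      show "M \<subseteq> {z. z \<squnion> u \<in> M}" by (rule rl_filter_subset_residual[OF fM])
      show "w \<squnion> v \<in> M" if "w \<in> generated_filter {u}" "v \<in> {z. z \<squnion> u \<in> M}" for w v
        using that generated_filter_least[OF rl_filter_residual[OF fM, of v], of "{u}"]
        by (auto simp: sup.commute)
    qed
    with np show False ..
  qed
  \<comment> \<open>The improper filter is generated by \<open>\<bottom>\<close>.\<close>
  moreover have "M \<noteq> UNIV" using np principal_UNIV by blast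
  ultimately have "prime_filter M" using fM by (auto simp: prime_filter_def)
  with assms alpha np show False by blast
qed

theorem proposition5p20:
  "let all_alpha_principal = (\<forall>F::'a::residuated_lattice set. alpha_filter F \<longrightarrow> principal_filter F);
       all_omega_principal = (\<forall>F::'a set. omega_filter F \<longrightarrow> principal_filter F);
       coannulets_principal_and_minimal_primes_nondense =
         ((\<forall>F::'a set. coannulet F \<longrightarrow> principal_filter F) \<and>
          (\<forall>P::'a set. minimal_prime_filter P \<longrightarrow> \<not> dense_set P));
       all_prime_alpha_principal =
         (\<forall>P::'a set. prime_filter P \<and> alpha_filter P \<longrightarrow> principal_filter P)
   in (all_alpha_principal \<longleftrightarrow> all_omega_principal) \<and>
      (all_omega_principal \<longleftrightarrow> coannulets_principal_and_minimal_primes_nondense) \<and>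
      (coannulets_principal_and_minimal_primes_nondense \<longleftrightarrow> all_prime_alpha_principal) \<and>
      (all_alpha_principal \<or> all_omega_principal \<or>
       coannulets_principal_and_minimal_primes_nondense \<or> all_prime_alpha_principal
         \<longrightarrow> quasicomplemented TYPE('a))"
proof -
  let ?alpha = "\<forall>F::'a set. alpha_filter F \<longrightarrow> principal_filter F"
  let ?omega = "\<forall>F::'a set. omega_filter F \<longrightarrow> principal_filter F"
  let ?coann = "\<forall>F::'a set. coannulet F \<longrightarrow> principal_filter F"
  let ?nondense = "\<forall>P::'a set. minimal_prime_filter P \<longrightarrow> \<not> dense_set P"
  let ?prime = "\<forall>P::'a set. prime_filter P \<and> alpha_filter P \<longrightarrow> principal_filter P"
  have 12: "?alpha \<Longrightarrow> ?omega" using alpha_filter_omega by (auto simp: omega_filter_def)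
  have 23: "?coann \<and> ?nondense" if ?omega
    using that coannulet_omega_filter omega_filter_minimal_prime
      minimal_prime_principal_not_dense by blast
  have 34: ?prime if "?coann \<and> ?nondense"
    using that quasicomplemented_if_coannulets_principal prime_alpha_filter_minimal
      prime_filter_not_dense_coannulet by blast
  have 41: "?prime \<Longrightarrow> ?alpha" by (rule alpha_filters_principal_if_primes_principal)
  \<comment> \<open>Around the cycle each assertion yields the third, whose coannulet half alone
    gives quasicomplements.\<close>
  have "?coann \<Longrightarrow> quasicomplemented TYPE('a)" by (rule quasicomplemented_if_coannulets_principal)
  then show ?thesis unfolding Let_def using 12 23 34 41 by argo
qed

end
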